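(* Let $N\ge 1$ be an integer and ${\mathcal X}\in\mathbb{R}$ such that the normalization constant $C_{{\mathcal X}}$ below is finite. For $A\in \mathrm{SO}(2N)$ with eigenvalues $e^{\pm i\theta_1},\dots,e^{\pm i\theta_N}$, $\theta_j\in[0,\pi]$, let $$\Lambda_A(e^{i\theta},N)=\det(I-e^{i\theta}A^{-1})=\prod_{k=1}^N(1-e^{i(\theta-\theta_k)})(1-e^{i(\theta+\theta_k)}),$$ so that $\Lambda_A(1,N)=2^N\prod_{j=1}^N(1-\cos\theta_j)$. Let $T_{{\mathcal X}}$ be the set of $A\in\mathrm{SO}(2N)$ with $\log|\Lambda_A(1,N)|\ge{\mathcal X}$, and define its one-level density by $$R_1^{T_{{\mathcal X}}}(\theta_1)=C_{{\mathcal X}}\, N\int_0^\pi\!\!\cdots\!\int_0^\pi H\big(\log|\Lambda_A(1,N)|-{\mathcal X}\big)\prod_{1\le j<k\le N}(\cos\theta_j-\cos\theta_k)^2\,d\theta_2\cdots d\theta_N,$$ where $H$ is the Heaviside function ($H(x)=1$ for $x>0$, $H(x)=0$ for $x<0$) and $C_{{\mathcal X}}$ is determined by $$1=C_{{\mathcal X}}\int_{[0,\pi]^N}H\big(\log\Lambda_A(1,N)-{\mathcal X}\big)\prod_{j<k}(\cos\theta_j-\cos\theta_k)^2\,d\theta_1\cdots d\theta_N.$$ Then, for any $c>0$, $$R_1^{T_{{\mathcal X}}}(\theta_1)=\frac{C_{{\mathcal X}}}{2\pi i}\int_{c-i\infty}^{c+i\infty}2^{Nr}\frac{\exp(-r{\mathcal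 X})}{r}\,R_1^{J_N}(\theta_1;r-1/2,-1/2)\,dr,$$ where $$R_1^{J_N}(\theta_1;r-1/2,-1/2)=N\int_0^\pi\!\!\cdots\!\int_0^\pi\prod_{j=1}^N w^{(r-1/2,-1/2)}(\cos\theta_j)\prod_{j<k}(\cos\theta_j-\cos\theta_k)^2\,d\theta_2\cdots d\theta_N$$ is the (Jacobi-ensemble) one-level density with weight $w^{(\alpha,\beta)}(\cos\theta)=(1-\cos\theta)^{\alpha+1/2}(1+\cos\theta)^{\beta+1/2}$, $\alpha=r-1/2$, $\beta=-1/2$.
   Context: The ensemble $T_{{\mathcal X}}$ (the "excised orthogonal ensemble") is the subset of $\mathrm{SO}(2N)$ equipped with Haar measure restricted and renormalized; in eigenphase coordinates the Haar measure on $\mathrm{SO}(2N)$ is proportional to $\prod_{j<k}(\cos\theta_j-\cos\theta_k)^2\,d\theta_1\cdots d\theta_N$ on $[0,\pi]^N$. The contour integral is along the vertical line $\mathrm{Re}(r)=c$.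
   Formalization: The value H(0) is left open in the statement; for N=1 at the single jump point 2(1-cos θ_1)=e^X the contour integral (taken as a symmetric limit) gives half the jump, so there the formula is claimed only when H(0)=1/2. *)

theory Defs
  imports "HOL-Complex_Analysis.Complex_Analysis" "Jordan_Normal_Form.Gauss_Jordan_Elimination"
    "Jordan_Normal_Form.Char_Poly"
begin

hide_const (open) Determinants.det

definition special_orthogonal :: "nat \<Rightarrow> real mat set" where
  "special_orthogonal n =
     {A \<in> carrier_mat n n. A * transpose_mat A = 1\<^sub>m n \<and> det A = 1}"

text \<open>
  The value at \<open>z\<close> of the characteristic polynomial \<open>det (I - z A\<^sup>-\<^sup>1)\<close>.
  The library function \<open>mat_inverse\<close> returns \<open>None\<close> for singular matrices only.
\<close>
definition Lambda_mat :: "real mat \<Rightarrow> complex \<Rightarrow> complex" where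
  "Lambda_mat A z =
     det (1\<^sub>m (dim_row A) - z \<cdot>\<^sub>m the (mat_inverse (map_mat complex_of_real A)))"

text \<open>
  The eigenvalues of \<open>A\<close>, with multiplicity, are \<open>exp (\<plusminus>i \<theta> k)\<close> for \<open>k = 1, \<dots>, N\<close>.
\<close>
definition eigenphases :: "nat \<Rightarrow> real mat \<Rightarrow> (nat \<Rightarrow> real) \<Rightarrow> bool" where
  "eigenphases N A \<theta> \<longleftrightarrow>
     (\<forall>k\<in>{1..N}. \<theta> k \<in> {0..pi}) \<and>
     char_poly (map_mat complex_of_real A) =
       (\<Prod>k\<in>{1..N}. [:- cis (\<theta> k), 1:] * [:- cis (- \<theta> k), 1:])"

text \<open>The same function in eigenphase coordinates, at the point \<open>exp (i \<phi>)\<close>.\<close>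
definition Lambda_phase :: "nat \<Rightarrow> (nat \<Rightarrow> real) \<Rightarrow> real \<Rightarrow> complex" where
  "Lambda_phase N \<theta> \<phi> =
     (\<Prod>k\<in>{1..N}. (1 - cis (\<phi> - \<theta> k)) * (1 - cis (\<phi> + \<theta> k)))"

text \<open>
  In HOL \<open>ln 0 = 0\<close>, whereas here \<open>log 0\<close> has to be \<open>-\<infinity>\<close>, because \<open>\<Lambda>\<close> vanishes
  identically in the remaining phases when one of them is 0.
\<close>
definition log_ext :: "real \<Rightarrow> ereal" where
  "log_ext x = (if x = 0 then - \<infinity> else ereal (ln x))"

definition excised_set :: "nat \<Rightarrow> real \<Rightarrow> real mat set" where
  "excised_set N X =
     {A \<in> special_orthogonal (2 * N). log_ext (cmod (Lambda_mat A 1)) \<ge> ereal X}"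

text \<open>
  The value at 0 is left open.
\<close>
definition is_heaviside :: "(ereal \<Rightarrow> real) \<Rightarrow> bool" where
  "is_heaviside H \<longleftrightarrow> (\<forall>x>0. H x = 1) \<and> (\<forall>x<0. H x = 0)"

definition phase_measure :: "nat set \<Rightarrow> (nat \<Rightarrow> real) measure" where
  "phase_measure I = Pi\<^sub>M I (\<lambda>_. restrict_space lborel {0..pi})"

definition vandermonde_sq :: "nat \<Rightarrow> (nat \<Rightarrow> real) \<Rightarrow> real" where
  "vandermonde_sq N \<theta> = (\<Prod>j\<in>{1..N}. \<Prod>k\<in>{j<..N}. (cos (\<theta> j) - cos (\<theta> k))\<^sup>2)"

definition excised_weight :: "(ereal \<Rightarrow> real) \<Rightarrow> nat \<Rightarrow> real \<Rightarrow> (nat \<Rightarrow> real) \<Rightarrow> real" where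
  "excised_weight H N X \<theta> =
     H (log_ext (cmod (Lambda_phase N \<theta> 0)) - ereal X) * vandermonde_sq N \<theta>"

definition excised_mass :: "(ereal \<Rightarrow> real) \<Rightarrow> nat \<Rightarrow> real \<Rightarrow> real" where
  "excised_mass H N X = (\<integral>\<theta>. excised_weight H N X \<theta> \<partial>phase_measure {1..N})"

definition excised_density ::
  "(ereal \<Rightarrow> real) \<Rightarrow> nat \<Rightarrow> real \<Rightarrow> real \<Rightarrow> real \<Rightarrow> real" where
  "excised_density H N X C t =
     C * real N * (\<integral>\<theta>. excised_weight H N X (\<theta>(1 := t)) \<partial>phase_measure {2..N})"

text \<open>
  In HOL \<open>0 powr 0 = 0\<close>; the factor \<open>(1 + x)\<close> with exponent 0 has to be 1
  also at \<open>x = -1\<close>.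
\<close>
definition cpow :: "complex \<Rightarrow> complex \<Rightarrow> complex" where
  "cpow x a = (if a = 0 then 1 else x powr a)"

definition jacobi_weight :: "complex \<Rightarrow> complex \<Rightarrow> real \<Rightarrow> complex" where
  "jacobi_weight \<alpha> \<beta> x =
     cpow (of_real (1 - x)) (\<alpha> + 1/2) * cpow (of_real (1 + x)) (\<beta> + 1/2)"

definition jacobi_density :: "nat \<Rightarrow> complex \<Rightarrow> complex \<Rightarrow> real \<Rightarrow> complex" where
  "jacobi_density N \<alpha> \<beta> t =
     of_nat N *
       (\<integral>\<theta>. (let \<theta>' = \<theta>(1 := t) in
           (\<Prod>j\<in>{1..N}. jacobi_weight \<alpha> \<beta> (cos (\<theta>' j))) * of_real (vandermonde_sq N \<theta>'))
        \<partial>phase_measure {2..N})"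

text \<open>
  The integral along \<open>Re r = c\<close> is the limit of the integrals over the symmetric
  segments from \<open>c - iT\<close> to \<open>c + iT\<close>; it need not converge absolutely.
\<close>
definition has_vertical_integral :: "(complex \<Rightarrow> complex) \<Rightarrow> real \<Rightarrow> complex \<Rightarrow> bool" where
  "has_vertical_integral f c I \<longleftrightarrow>
     (\<forall>T>0. f contour_integrable_on linepath (Complex c (- T)) (Complex c T)) \<and>
     ((\<lambda>T. contour_integral (linepath (Complex c (- T)) (Complex c T)) f) \<longlongrightarrow> I) at_top"

end

theory Submission
  imports Defs "HOL-Probability.Sinc_Integral"
begin

text \<open>
  With \<open>y = \<Prod>j. 2 (1 - cos (\<theta> j))\<close> the integrand on the right-hand side is the integral over the
  remaining phases of \<open>exp (r (ln y - X)) / r\<close> against the squared Vandermonde, so that after Fubini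
  the claim is Perron's formula under the integral sign. Differentiating the truncated Perron
  integral at \<open>u = ln y - X\<close> with respect to \<open>u\<close> removes the factor \<open>1 / r\<close> and leaves a Dirichlet
  kernel; integrating back from \<open>-\<infinity>\<close>, by parts, expresses it through the bounded function \<open>Si\<close>.
  This gives both the limit and a bound uniform in the truncation height, hence dominated
  convergence. The limit takes the value 1/2 where \<open>y = exp X\<close>, which is a null set as soon as
  a phase is left to integrate.
\<close>

section \<open>Characteristic polynomials in eigenphase coordinates\<close>

text \<open>Multiplying \<open>1 - z B\<close>, with \<open>B\<close> the inverse of
  \<open>A\<close>, by \<open>A\<close> costs nothing since \<open>det A = 1\<close>, and turns it
  into \<open>A - z\<close>. Passing to \<open>z - A\<close> costs a sign that the even dimension
  cancels.\<close>

lemma Lambda_mat_eq_char_poly: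
  assumes A: "A \<in> special_orthogonal (2 * N)"
  shows "Lambda_mat A z = poly (char_poly (map_mat complex_of_real A)) z"
proof -
  define n where "n = 2 * N"
  define Ac where "Ac = map_mat complex_of_real A"
  have An: "A \<in> carrier_mat n n" and dA: "Determinant.det A = 1"
    using A by (auto simp: special_orthogonal_def n_def)
  have Acn: "Ac \<in> carrier_mat n n" using An by (simp add: Ac_def)
  have dAc: "Determinant.det Ac = 1"
    by (simp add: Ac_def dA of_real_hom.hom_det)
  \<comment> \<open>Both facts concern units of \<open>ring_mat\<close>, a record with an arbitrary
    extra component; \<open>undefined\<close> fixes the same one in each.\<close>
  obtain B where B: "mat_inverse Ac = Some B"
    using mat_inverse(1)[OF Acn, of undefined] det_non_zero_imp_unit[OF Acn, of undefined] dAc by fastforce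
  have AB: "Ac * B = 1\<^sub>m n" and Bn: "B \<in> carrier_mat n n"
    using mat_inverse(2)[OF Acn B] by auto
  have n: "dim_row A = n" using An by auto
  have "Lambda_mat A z = Determinant.det (1\<^sub>m n - z \<cdot>\<^sub>m B)"
    unfolding Lambda_mat_def Ac_def[symmetric] B n by simp
  also have "\<dots> = Determinant.det (Ac * (1\<^sub>m n - z \<cdot>\<^sub>m B))"
    using Acn Bn dAc by (subst det_mult[OF Acn]) auto
  also have "Ac * (1\<^sub>m n - z \<cdot>\<^sub>m B) = Ac - z \<cdot>\<^sub>m 1\<^sub>m n"
    using Acn Bn AB by (subst mult_minus_distrib_mat[OF Acn]) (auto simp: mult_smult_distrib)
  also have "Ac - z \<cdot>\<^sub>m 1\<^sub>m n = (-1) \<cdot>\<^sub>m (- char_matrix Ac z)"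
    using Acn by (intro eq_matI) (auto simp: char_matrix_def)
  also have "Determinant.det \<dots> = Determinant.det (- char_matrix Ac z)"
    using Acn by (auto simp: det_smult char_matrix_def n_def)
  also have "\<dots> = poly (char_poly Ac) z"
    using char_poly_matrix[OF Acn] by simp
  finally show ?thesis by (simp add: Ac_def)
qed

lemma Lambda_mat_cis:
  assumes "A \<in> special_orthogonal (2 * N)" and "eigenphases N A \<theta>"
  shows "Lambda_mat A (cis \<phi>) = Lambda_phase N \<theta> \<phi>"
proof -
  have "(cis \<phi> - cis t) * (cis \<phi> - cis (- t)) = (1 - cis (\<phi> - t)) * (1 - cis (\<phi> + t))" for t
    by (simp add: algebra_simps cis_mult)
  moreover have "char_poly (map_mat complex_of_real A) =
      (\<Prod>k\<in>{1..N}. [:- cis (\<theta> k), 1:] * [:- cis (- \<theta> k), 1:])"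
    using assms(2) by (simp only: eigenphases_def)
  hence "Lambda_mat A (cis \<phi>) =
      (\<Prod>k\<in>{1..N}. (cis \<phi> - cis (\<theta> k)) * (cis \<phi> - cis (- \<theta> k)))"
    by (simp only: Lambda_mat_eq_char_poly[OF assms(1)] poly_prod poly_mult) simp
  ultimately show ?thesis by (simp only: Lambda_phase_def)
qed

text \<open>The two factors at each phase are complex conjugates, so the value is real and
  nonnegative; this is what lets \<open>cmod\<close> disappear later.\<close>

lemma Lambda_phase_0:
  "Lambda_phase N \<theta> 0 = of_real (\<Prod>j\<in>{1..N}. 2 * (1 - cos (\<theta> j)))"
proof -
  have "(1 - cis (- t)) * (1 - cis t) = of_real (2 * (1 - cos t))" for t
    by (simp add: algebra_simps cis_mult)  (simp add: complex_eq_iff)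
  thus ?thesis by (simp add: Lambda_phase_def)
qed

section \<open>Perron's formula with a uniform bound\<close>

text \<open>
  With \<open>r = c + i s\<close>, so the contour integral of \<open>exp (r u) / r\<close> up to height \<open>T\<close> is \<open>\<i>\<close> times this.
\<close>
definition perron_kernel :: "real \<Rightarrow> real \<Rightarrow> real \<Rightarrow> complex" where
  "perron_kernel c T u = integral {-T..T} (\<lambda>s. exp (Complex c s * of_real u) / Complex c s)"

text \<open>The source of domination for the half-line integrals below: their other factors,
  \<open>Si\<close> and \<open>sgn\<close>, are bounded, so \<open>c > 0\<close> gives convergence
  at minus infinity.\<close>

lemma set_integrable_exp_atMost:
  assumes "(c::real) > 0"
  shows "set_integrable lborel (einterval (-\<infinity>) (ereal u)) (\<lambda>x. exp (c * x))"
    and "(LBINT x=-\<infinity>..u. exp (c * x)) = exp (c * u) / c"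
proof -
  have lim: "((\<lambda>x. exp (c * x) / c) \<longlongrightarrow> 0) at_bot"
    using assms by real_asymp
  have D: "((\<lambda>x. exp (c * x) / c) has_real_derivative exp (c * x)) (at x)" for x
    using assms by (auto intro!: derivative_eq_intros)
  have A: "(((\<lambda>x. exp (c * x) / c) \<circ> real_of_ereal) \<longlongrightarrow> 0) (at_right (-\<infinity>))"
    using lim by (simp add: ereal_tendsto_simps)
  have B: "(((\<lambda>x. exp (c * x) / c) \<circ> real_of_ereal) \<longlongrightarrow> exp (c * u) / c) (at_left (ereal u))"
    using assms by (auto simp: ereal_tendsto_simps intro!: tendsto_eq_intros)
  note F = interval_integral_FTC_nonneg[of "-\<infinity>" "ereal u", OF _ D _ _ A B]
  show "set_integrable lborel (einterval (-\<infinity>) (ereal u)) (\<lambda>x. exp (c * x))"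
    by (rule F(1)) auto
  have "(LBINT x=-\<infinity>..u. exp (c * x)) = exp (c * u) / c - 0"
    by (rule F(2)) auto
  thus "(LBINT x=-\<infinity>..u. exp (c * x)) = exp (c * u) / c" by simp
qed

text \<open>This is the Dirichlet kernel. The form \<open>T * sinc (T * u)\<close> instead of
  \<open>sin (T * u) / u\<close> has the right value at \<open>u = 0\<close> and is the derivative
  of \<open>Si (T * u)\<close> in \<open>u\<close>.\<close>

lemma integral_exp_vertical:
  assumes "T > 0"
  shows "integral {-T..T} (\<lambda>s. exp (Complex c s * of_real u)) =
         of_real (2 * exp (c * u) * (T * sinc (T * u)))"
proof (cases "u = 0")
  case True
  thus ?thesis using assms by (simp add: scaleR_conv_of_real)
next
  case False
  have "((\<lambda>s. exp (Complex c s * of_real u)) has_integral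
      exp (Complex c T * of_real u) / (\<i> * of_real u) - exp (Complex c (-T) * of_real u) / (\<i> * of_real u))
      {-T..T}"
  proof (rule fundamental_theorem_of_calculus)
    fix s assume "s \<in> {-T..T}"
    \<comment> \<open>The derivative is taken in a complex variable first and then restricted to the
      real line.\<close>
    have "((\<lambda>z. exp ((of_real c + \<i> * z) * of_real u) / (\<i> * of_real u)) has_field_derivative
             exp ((of_real c + \<i> * of_real s) * of_real u)) (at (of_real s))"
      using False by (auto intro!: derivative_eq_intros)
    hence "((\<lambda>s. exp ((of_real c + \<i> * of_real s) * of_real u) / (\<i> * of_real u)) has_vector_derivative
             exp ((of_real c + \<i> * of_real s) * of_real u)) (at s within {-T..T})"
      by (rule has_vector_derivative_real_field)
    thus "((\<lambda>s. exp (Complex c s * of_real u) / (\<i> * of_real u)) has_vector_derivative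
             exp (Complex c s * of_real u)) (at s within {-T..T})"
      by (simp add: Complex_eq)
  qed (use assms in auto)
  hence "integral {-T..T} (\<lambda>s. exp (Complex c s * of_real u)) =
      (exp (Complex c T * of_real u) - exp (Complex c (-T) * of_real u)) / (\<i> * of_real u)"
    by (simp add: integral_unique diff_divide_distrib)
  also have "\<dots> = of_real (2 * exp (c * u) * (sin (T * u) / u))"
    using False by (simp add: complex_eq_iff Re_divide Im_divide Re_exp Im_exp power2_eq_square)
  also have "sin (T * u) / u = T * sinc (T * u)"
    using False assms by simp
  finally show ?thesis .
qed

text \<open>Crude, and growing with \<open>T\<close>. It serves only to show decay as
  \<open>u\<close> tends to minus infinity for fixed \<open>T\<close>, which fixes the constant of
  integration.\<close>

lemma perron_kernel_bound:
  assumes "c > 0" "T > 0"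
  shows "norm (perron_kernel c T u) \<le> exp (c * u) / c * (2 * T)"
proof -
  have "norm (integral (cbox (-T) T) (\<lambda>s. exp (Complex c s * of_real u) / Complex c s))
        \<le> exp (c * u) / c * measure lborel (cbox (-T) T)"
  proof (rule integrable_bound)
    show "(\<lambda>s. exp (Complex c s * of_real u) / Complex c s) integrable_on cbox (-T) T"
      using assms by (intro integrable_continuous continuous_intros) (auto simp: complex_eq_iff)
    fix s
    have "c \<le> norm (Complex c s)" using abs_Re_le_cmod[of "Complex c s"] assms by simp
    thus "norm (exp (Complex c s * of_real u) / Complex c s) \<le> exp (c * u) / c"
      using assms by (auto simp: norm_divide norm_exp_eq_Re intro!: divide_left_mono mult_pos_pos)
  qed (use assms in auto)
  thus ?thesis using assms by (simp add: perron_kernel_def)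
qed

text \<open>Differentiation under the integral sign multiplies the integrand by
  \<open>Complex c s\<close> and so cancels the denominator.\<close>

lemma perron_kernel_has_derivative:
  assumes "c > 0" "T > 0"
  shows "((\<lambda>u. perron_kernel c T u) has_vector_derivative
           of_real (2 * exp (c * u) * (T * sinc (T * u)))) (at u)"
proof -
  have "((\<lambda>u. integral (cbox (-T) T) (\<lambda>s. exp (Complex c s * of_real u) / Complex c s))
      has_vector_derivative integral (cbox (-T) T) (\<lambda>s. exp (Complex c s * of_real u))) (at u within UNIV)"
  proof (rule leibniz_rule_vector_derivative)
    fix u s assume "s \<in> cbox (-T) T"
    have "((\<lambda>z. exp (Complex c s * z) / Complex c s) has_field_derivative
             exp (Complex c s * of_real u)) (at (of_real u))"
      using assms by (auto intro!: derivative_eq_intros simp: complex_eq_iff)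
    thus "((\<lambda>u. exp (Complex c s * of_real u) / Complex c s) has_vector_derivative
             exp (Complex c s * of_real u)) (at u within UNIV)"
      by (rule has_vector_derivative_real_field)
  next
    fix u
    show "(\<lambda>s. exp (Complex c s * of_real u) / Complex c s) integrable_on cbox (-T) T"
      using assms by (intro integrable_continuous continuous_intros) (auto simp: complex_eq_iff)
  next
    show "continuous_on (UNIV \<times> cbox (-T) T) (\<lambda>(u, s). exp (Complex c s * of_real u))"
      unfolding case_prod_beta by (intro continuous_intros)
  qed auto
  thus ?thesis using integral_exp_vertical[OF assms(2), of c u]
    by (simp add: perron_kernel_def)
qed

lemma set_integrable_exp_Si:
  assumes "c > 0"
  shows "set_integrable lborel (einterval (-\<infinity>) (ereal u)) (\<lambda>x. exp (c * x) * Si (T * x))"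
proof -
  obtain B where B: "\<And>x. \<bar>Si x\<bar> \<le> B" using bounded_Si by blast
  have "set_integrable lborel (einterval (-\<infinity>) (ereal u)) (\<lambda>x. exp (c * x) * B)"
    using set_integrable_exp_atMost(1)[OF assms] by (intro set_integrable_mult_left) auto
  thus ?thesis
  proof (rule set_integrable_bound)
    show "AE x in lborel. x \<in> einterval (-\<infinity>) (ereal u) \<longrightarrow>
        norm (exp (c * x) * Si (T * x)) \<le> norm (exp (c * x) * B)"
      using order_trans[OF B abs_ge_self] by (intro AE_I2) (auto simp: abs_mult)
  qed (simp add: set_borel_measurable_def)
qed

text \<open>Integration by parts on the half-line. On the right \<open>T\<close> occurs only inside
  the bounded function \<open>Si\<close>, so both a uniform bound and the limit can be read
  off.\<close>

lemma perron_kernel_eq: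
  assumes "c > 0" "T > 0"
  shows "perron_kernel c T u =
           of_real (2 * exp (c * u) * Si (T * u) - 2 * c * (LBINT x=-\<infinity>..u. exp (c * x) * Si (T * x)))"
proof -
  obtain B where B: "\<And>x. \<bar>Si x\<bar> \<le> B" using bounded_Si by blast
  \<comment> \<open>The kernel minus the boundary term of the integration by parts: the Dirichlet
    kernels cancel in the derivative of \<open>h\<close>, which leaves a multiple of
    \<open>exp (c * x) * Si (T * x)\<close>.\<close>
  define h where "h u = perron_kernel c T u - of_real (2 * exp (c * u) * Si (T * u))" for u
  have D: "(h has_vector_derivative of_real (- (2 * c) * (exp (c * x) * Si (T * x)))) (at x)" for x
  proof -
    have "((\<lambda>x. 2 * exp (c * x) * Si (T * x)) has_real_derivative
        2 * exp (c * x) * (T * sinc (T * x)) + 2 * c * exp (c * x) * Si (T * x)) (at x)"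
      by (rule derivative_eq_intros DERIV_Si[THEN DERIV_chain2] refl | simp)+
    hence "((\<lambda>x. complex_of_real (2 * exp (c * x) * Si (T * x))) has_vector_derivative
        of_real (2 * exp (c * x) * (T * sinc (T * x)) + 2 * c * exp (c * x) * Si (T * x))) (at x)"
      by (intro has_vector_derivative_of_real) (simp add: has_real_derivative_iff_has_vector_derivative)
    from has_vector_derivative_diff[OF perron_kernel_has_derivative[OF assms] this]
    show ?thesis unfolding h_def by (simp add: algebra_simps)
  qed
  have h_bot: "(h \<longlongrightarrow> 0) at_bot"
  proof (rule Lim_null_comparison)
    show "\<forall>\<^sub>F u in at_bot. norm (h u) \<le> exp (c * u) * (2 * T / c + 2 * B)"
    proof (intro always_eventually allI)
      fix u
      have "norm (h u) \<le> exp (c * u) / c * (2 * T) + norm (complex_of_real (2 * exp (c * u) * Si (T * u)))"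
        unfolding h_def by (intro order_trans[OF norm_triangle_ineq4] add_right_mono perron_kernel_bound assms)
      also have "norm (complex_of_real (2 * exp (c * u) * Si (T * u))) \<le> 2 * exp (c * u) * B"
        unfolding norm_of_real using B by (simp add: abs_mult)
      finally show "norm (h u) \<le> exp (c * u) * (2 * T / c + 2 * B)"
        by (simp add: algebra_simps)
    qed
    have "((\<lambda>u. exp (c * u)) \<longlongrightarrow> 0) at_bot" using assms by real_asymp
    thus "((\<lambda>u. exp (c * u) * (2 * T / c + 2 * B)) \<longlongrightarrow> 0) at_bot"
      by (rule tendsto_mult_left_zero)
  qed
  have "(LBINT x=-\<infinity>..u. complex_of_real (- (2 * c) * (exp (c * x) * Si (T * x)))) = h u - 0"
  proof (rule interval_integral_FTC_integrable)
    show "((h \<circ> real_of_ereal) \<longlongrightarrow> 0) (at_right (-\<infinity>))"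
      using h_bot by (simp add: ereal_tendsto_simps)
    show "((h \<circ> real_of_ereal) \<longlongrightarrow> h u) (at_left (ereal u))"
      using has_vector_derivative_continuous[OF D, of u]
      by (auto simp: ereal_tendsto_simps continuous_within intro: tendsto_within_subset)
    show "isCont (\<lambda>x. complex_of_real (- (2 * c) * (exp (c * x) * Si (T * x)))) x" for x
      by (intro continuous_intros isCont_o2[OF _ isCont_Si])
    show "set_integrable lborel (einterval (-\<infinity>) (ereal u))
        (\<lambda>x. complex_of_real (- (2 * c) * (exp (c * x) * Si (T * x))))"
    proof -
      have "set_integrable lborel (einterval (-\<infinity>) (ereal u)) (\<lambda>x. - (2 * c) * (exp (c * x) * Si (T * x)))"
        using set_integrable_exp_Si[OF assms(1), of u T] by (intro set_integrable_mult_right) auto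
      from integrable_of_real[OF this[unfolded set_integrable_def], where 'a = complex] show ?thesis
        unfolding set_integrable_def by (simp add: scaleR_conv_of_real)
    qed
  qed (use D in auto)
  hence "h u = of_real (- (2 * c) * (LBINT x=-\<infinity>..u. exp (c * x) * Si (T * x)))"
    by (simp only: interval_lebesgue_integral_of_real interval_lebesgue_integral_mult_right diff_0_right)
  thus ?thesis by (simp add: h_def algebra_simps)
qed

lemma perron_kernel_uniform_bound:
  assumes "c > 0"
  obtains B where "B \<ge> 0" "\<And>T u. T > 0 \<Longrightarrow> norm (perron_kernel c T u) \<le> B * exp (c * u)"
proof -
  obtain B where B: "\<And>x. \<bar>Si x\<bar> \<le> B" using bounded_Si by blast
  have "B \<ge> 0" using order_trans[OF abs_ge_zero B] .
  \<comment> \<open>The boundary term and the integral term contribute \<open>2 * B\<close> each; in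
    the latter the factor \<open>c\<close> cancels against the \<open>1 / c\<close> from integrating
    the exponential.\<close>
  have "norm (perron_kernel c T u) \<le> 4 * B * exp (c * u)" if T: "T > 0" for T u
  proof -
    have "\<bar>LBINT x=-\<infinity>..u. exp (c * x) * Si (T * x)\<bar> \<le> (LBINT x=-\<infinity>..u. exp (c * x) * B)"
      unfolding interval_lebesgue_integral_le_eq[OF ereal_less_eq(2)] set_lebesgue_integral_def
        real_norm_def[symmetric]
    proof (rule Bochner_Integration.integral_norm_bound_integral)
      show "integrable lborel (\<lambda>x. indicator (einterval (-\<infinity>) (ereal u)) x *\<^sub>R (exp (c * x) * Si (T * x)))"
        using set_integrable_exp_Si[OF assms] by (simp add: set_integrable_def)
      show "integrable lborel (\<lambda>x. indicator (einterval (-\<infinity>) (ereal u)) x *\<^sub>R (exp (c * x) * B))"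
        using set_integrable_mult_left[OF set_integrable_exp_atMost(1)[OF assms]]
        by (simp add: set_integrable_def)
    qed (use B in \<open>auto simp: indicator_def abs_mult\<close>)
    also have "\<dots> = B * exp (c * u) / c"
      using set_integrable_exp_atMost(2)[OF assms, of u] by simp
    finally have "2 * c * \<bar>LBINT x=-\<infinity>..u. exp (c * x) * Si (T * x)\<bar> \<le> 2 * B * exp (c * u)"
      using assms by (simp add: field_simps)
    moreover have "\<bar>2 * exp (c * u) * Si (T * u)\<bar> \<le> 2 * B * exp (c * u)"
      using B by (simp add: abs_mult)
    ultimately have "\<bar>2 * exp (c * u) * Si (T * u) - 2 * c * (LBINT x=-\<infinity>..u. exp (c * x) * Si (T * x))\<bar>
        \<le> 2 * B * exp (c * u) + 2 * B * exp (c * u)"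
      using assms by (intro order_trans[OF abs_triangle_ineq4] add_mono) (auto simp: abs_mult)
    also have "\<dots> = 4 * B * exp (c * u)" by simp
    finally    show ?thesis unfolding perron_kernel_eq[OF assms T] norm_of_real .
  qed
  thus ?thesis using that[of "4 * B"] \<open>B \<ge> 0\<close> by simp
qed

section \<open>The limit of the truncated Perron integral\<close>

lemma tendsto_Si_mult: "((\<lambda>T. Si (T * x)) \<longlongrightarrow> sgn x * (pi / 2)) at_top"
proof -
  have pos: "((\<lambda>T. Si (T * y)) \<longlongrightarrow> pi / 2) at_top" if "y > 0" for y
    by (rule filterlim_compose[OF Si_at_top])
       (use that in \<open>auto intro: filterlim_at_top_mult_tendsto_pos[OF tendsto_const] filterlim_ident\<close>)
  consider "x > 0" | "x = 0" | "x < 0" by linarith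
  thus ?thesis
  proof cases
    case 3
    \<comment> \<open>Negative \<open>x\<close> reduces to positive \<open>x\<close> because
      \<open>Si\<close> is odd.\<close>
    have "((\<lambda>T. - Si (T * (-x))) \<longlongrightarrow> - (pi / 2)) at_top"
      by (intro tendsto_minus pos) (use 3 in auto)
    moreover have "\<forall>\<^sub>F T in at_top. - Si (T * (-x)) = Si (T * x)"
      using eventually_ge_at_top[of 0]
    proof eventually_elim
      case (elim T)
      thus ?case using 3 Si_neg[of "T * (-x)"] by (simp add: mult_nonneg_nonpos)
    qed
    ultimately show ?thesis using 3 by (simp add: Lim_transform_eventually)
  next
    case 2
    thus ?thesis by (simp add: Si_def zero_ereal_def[symmetric])
  qed (use pos in auto)
qed

text \<open>The absolute value merges two cases: \<open>- exp (c * u) / c\<close> for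
  \<open>u\<close> at most 0, and \<open>(exp (c * u) - 2) / c\<close> for positive
  \<open>u\<close>, where the part below 0 contributes \<open>- 1 / c\<close>.\<close>

lemma LBINT_exp_sgn:
  assumes "c > 0"
  shows "(LBINT x=-\<infinity>..u. exp (c * x) * sgn x) = (\<bar>exp (c * u) - 1\<bar> - 1) / c"
proof -
  have neg: "(LBINT x=-\<infinity>..v. exp (c * x) * sgn x) = - (exp (c * v) / c)" if "v \<le> 0" for v
  proof -
    have "(LBINT x=-\<infinity>..v. exp (c * x) * sgn x) = (LBINT x=-\<infinity>..v. exp (c * x) * (-1))"
    proof (rule interval_integral_cong)
      fix x assume "x \<in> einterval (min (-\<infinity>) (ereal v)) (max (-\<infinity>) (ereal v))"
      thus "exp (c * x) * sgn x = exp (c * x) * (-1)" using that by (auto simp: einterval_def)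
    qed
    thus ?thesis
      by (simp only: interval_lebesgue_integral_mult_left set_integrable_exp_atMost(2)[OF assms])
  qed
  show ?thesis
  proof (cases "u \<le> 0")
    case True
    thus ?thesis using neg[OF True] assms by (simp add: mult_nonneg_nonpos)
  next
    case False
    have "(LBINT x=ereal 0..ereal u. exp (c * x) * sgn x) = (LBINT x=ereal 0..ereal u. exp (c * x))"
      using False by (intro interval_integral_cong) (auto simp: einterval_def)
    also have "\<dots> = exp (c * u) / c - exp (c * 0) / c"
      using assms
      by (intro interval_integral_FTC_finite)
         (auto intro!: continuous_intros derivative_eq_intros
               simp: has_real_derivative_iff_has_vector_derivative[symmetric])
    finally have "(LBINT x=ereal 0..ereal u. exp (c * x) * sgn x) = (exp (c * u) - 1) / c"
      by (simp add: diff_divide_distrib)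
    moreover have "(LBINT x=-\<infinity>..ereal 0. exp (c * x) * sgn x) + (LBINT x=ereal 0..ereal u. exp (c * x) * sgn x)
        = (LBINT x=-\<infinity>..ereal u. exp (c * x) * sgn x)"
    proof (rule interval_integral_sum)
      have "set_integrable lborel (einterval (-\<infinity>) (ereal u)) (\<lambda>x. exp (c * x) * sgn x)"
        by (rule set_integrable_bound[OF set_integrable_exp_atMost(1)[OF assms]])
           (auto simp: set_borel_measurable_def abs_mult sgn_if)
      thus "interval_lebesgue_integrable lborel (min (-\<infinity>) (min (ereal 0) (ereal u)))
          (max (-\<infinity>) (max (ereal 0) (ereal u))) (\<lambda>x. exp (c * x) * sgn x)"
        using False by (simp add: interval_lebesgue_integrable_def min_def max_def)
    qed
    moreover have "\<bar>exp (c * u) - 1\<bar> = exp (c * u) - 1" using False assms by simp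
    ultimately show ?thesis using neg[of 0] by (simp add: diff_divide_distrib)
  qed
qed

text \<open>The limit is \<open>2 * pi\<close>, \<open>pi\<close> or 0 according to the sign of
  \<open>u\<close>. It comes from replacing \<open>Si (T * x)\<close> by its limit in
  \<open>perron_kernel_eq\<close>, under the integral by dominated convergence.\<close>

lemma perron_kernel_tendsto:
  assumes "c > 0"
  shows "((\<lambda>T. perron_kernel c T u) \<longlongrightarrow> of_real (pi * (1 + sgn u))) at_top"
proof -
  obtain B where B: "\<And>x. \<bar>Si x\<bar> \<le> B" using bounded_Si by blast
  have "((\<lambda>T. LBINT x=-\<infinity>..u. exp (c * x) * Si (T * x)) \<longlongrightarrow>
          (LBINT x=-\<infinity>..u. exp (c * x) * (sgn x * (pi / 2)))) at_top"
    unfolding interval_lebesgue_integral_le_eq[OF ereal_less_eq(2)] set_lebesgue_integral_def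
  proof (rule integral_dominated_convergence_at_top)
    show "integrable lborel (\<lambda>x. indicator (einterval (-\<infinity>) (ereal u)) x *\<^sub>R (exp (c * x) * B))"
      using set_integrable_mult_left[OF set_integrable_exp_atMost(1)[OF assms]]
      by (simp add: set_integrable_def)
    show "AE x in lborel. ((\<lambda>T. indicator (einterval (-\<infinity>) (ereal u)) x *\<^sub>R (exp (c * x) * Si (T * x))) \<longlongrightarrow>
        indicator (einterval (-\<infinity>) (ereal u)) x *\<^sub>R (exp (c * x) * (sgn x * (pi / 2)))) at_top"
      by (intro AE_I2 tendsto_intros tendsto_Si_mult)
    show "\<forall>\<^sub>F T in at_top. AE x in lborel.
        norm (indicator (einterval (-\<infinity>) (ereal u)) x *\<^sub>R (exp (c * x) * Si (T * x)))
        \<le> indicator (einterval (-\<infinity>) (ereal u)) x *\<^sub>R (exp (c * x) * B)"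
      using B by (intro always_eventually allI AE_I2) (auto simp: indicator_def abs_mult)
  qed (measurable, auto simp: sgn_if simp flip: lessThan_def)
  also have "(LBINT x=-\<infinity>..u. exp (c * x) * (sgn x * (pi / 2))) = (\<bar>exp (c * u) - 1\<bar> - 1) / c * (pi / 2)"
    using LBINT_exp_sgn[OF assms, of u] interval_lebesgue_integral_mult_left[of lborel "-\<infinity>" u "\<lambda>x. exp (c * x) * sgn x" "pi / 2"]
    by (simp add: mult.assoc)
  finally have lim: "((\<lambda>T. complex_of_real (2 * exp (c * u) * Si (T * u) -
         2 * c * (LBINT x=-\<infinity>..u. exp (c * x) * Si (T * x)))) \<longlongrightarrow>
       of_real (2 * exp (c * u) * (sgn u * (pi / 2)) - 2 * c * ((\<bar>exp (c * u) - 1\<bar> - 1) / c * (pi / 2)))) at_top"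
    by (intro tendsto_intros tendsto_Si_mult)
  \<comment> \<open>For nonzero \<open>u\<close> the two exponential terms cancel.\<close>
  also have "2 * exp (c * u) * (sgn u * (pi / 2)) - 2 * c * ((\<bar>exp (c * u) - 1\<bar> - 1) / c * (pi / 2))
       = pi * (1 + sgn u)"
    using assms mult_pos_neg[of c u] mult_pos_pos[of c u]
    by (cases u "0 :: real" rule: linorder_cases) (auto simp: abs_if mult_less_0_iff zero_less_mult_iff field_simps)
  finally show ?thesis
    by (rule Lim_transform_eventually)
       (rule eventually_mono[OF eventually_gt_at_top[of 0]], rule perron_kernel_eq[OF assms, symmetric])
qed

section \<open>Perron's formula under an integral\<close>

text \<open>On the line \<open>r = c + i s\<close> one has \<open>dr = i ds\<close>, whence the
  factor in front.\<close>

lemma has_vertical_integralI: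
  assumes "\<And>T. T > 0 \<Longrightarrow> ((\<lambda>s. f (Complex c s)) has_integral J T) {-T..T}"
    and "(J \<longlongrightarrow> j) at_top"
  shows "has_vertical_integral f c (\<i> * j)"
proof -
  have *: "(f has_contour_integral (\<i> * J T)) (linepath (Complex c (- T)) (Complex c T))" if "T > 0" for T
    by (subst has_contour_integral_linepath_same_Re_iff[where c = c and a = "-T" and b = T])
       (use assms(1)[OF that] that in \<open>auto simp flip: mult.assoc\<close>)
  have "((\<lambda>T. \<i> * J T) \<longlongrightarrow> \<i> * j) at_top"
    by (intro tendsto_intros assms)
  moreover have "\<forall>\<^sub>F T in at_top. \<i> * J T = contour_integral (linepath (Complex c (- T)) (Complex c T)) f"
    using eventually_gt_at_top[of 0]
    by eventually_elim (use * in \<open>metis contour_integral_unique\<close>)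
  ultimately have "((\<lambda>T. contour_integral (linepath (Complex c (- T)) (Complex c T)) f) \<longlongrightarrow> \<i> * j) at_top"
    by (rule Lim_transform_eventually)
  thus ?thesis unfolding has_vertical_integral_def
    using * by (auto simp: contour_integrable_on_def)
qed

text \<open>Agreement on the line alone suffices. For \<open>c > 0\<close> this avoids
  \<open>r = 0\<close>, where the integrands are singular and \<open>cpow\<close> switches to its
  other case.\<close>

lemma has_vertical_integral_mult_cong:
  assumes g: "has_vertical_integral g c I" and f: "\<And>r. Re r = c \<Longrightarrow> f r = a * g r"
  shows "has_vertical_integral f c (a * I)"
proof -
  have eq: "f r = a * g r" if "r \<in> path_image (linepath (Complex c (- T)) (Complex c T))" for r T
  proof (rule f)
    from that obtain u where "r = (1 - u) *\<^sub>R Complex c (- T) + u *\<^sub>R Complex c T"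
      by (auto simp: closed_segment_def)
    hence "Re r = (1 - u) * c + u * c" by simp
    thus "Re r = c" by (simp add: algebra_simps)
  qed
  have int: "(f has_contour_integral (a * contour_integral (linepath (Complex c (- T)) (Complex c T)) g))
      (linepath (Complex c (- T)) (Complex c T))" if "T > 0" for T
  proof (rule has_contour_integral_eq)
    show "((\<lambda>r. a * g r) has_contour_integral (a * contour_integral (linepath (Complex c (- T)) (Complex c T)) g))
      (linepath (Complex c (- T)) (Complex c T))"
      using g that unfolding has_vertical_integral_def
      by (intro has_contour_integral_lmul has_contour_integral_integral) auto
  qed (use eq in auto)
  have "((\<lambda>T. a * contour_integral (linepath (Complex c (- T)) (Complex c T)) g) \<longlongrightarrow> a * I) at_top"
    using g unfolding has_vertical_integral_def by (intro tendsto_intros) auto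
  moreover have "\<forall>\<^sub>F T in at_top. a * contour_integral (linepath (Complex c (- T)) (Complex c T)) g =
      contour_integral (linepath (Complex c (- T)) (Complex c T)) f"
    using eventually_gt_at_top[of 0]
    by eventually_elim (use int in \<open>metis contour_integral_unique\<close>)
  ultimately have "((\<lambda>T. contour_integral (linepath (Complex c (- T)) (Complex c T)) f) \<longlongrightarrow> a * I) at_top"
    by (rule Lim_transform_eventually)
  thus ?thesis unfolding has_vertical_integral_def
    using int by (auto simp: contour_integrable_on_def)
qed

section \<open>From Lebesgue integrals, needed for Fubini, to gauge integrals, needed for
  contours\<close>

lemma has_integral_restrict_lborel:
  fixes f :: "'a::euclidean_space \<Rightarrow> 'b::euclidean_space"
  assumes "S \<in> sets borel" "integrable (restrict_space lborel S) f"
  shows "(f has_integral (\<integral>x. f x \<partial>restrict_space lborel S)) S"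
proof -
  have "set_integrable lborel S f"
    using assms by (simp add: set_integrable_def integrable_restrict_space)
  from set_borel_integral_eq_integral[OF this] show ?thesis
    using assms by (simp add: has_integral_iff integral_restrict_space set_lebesgue_integral_def)
qed

lemma integral_restrict_lborel_continuous:
  fixes f :: "real \<Rightarrow> 'b::euclidean_space"
  assumes "continuous_on {a..b} f"
  shows "(\<integral>x. f x \<partial>restrict_space lborel {a..b}) = integral {a..b} f"
proof -
  have "set_integrable lborel {a..b} f"
    using borel_integrable_atLeastAtMost'[OF assms] .
  hence "integrable (restrict_space lborel {a..b}) f"
    by (simp add: set_integrable_def integrable_restrict_space)
  from has_integral_restrict_lborel[OF _ this] show ?thesis
    by (simp add: integral_unique)
qed

lemma finite_measure_lborel_Icc: "finite_measure (restrict_space lborel {a..b::real})"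
  by (rule finite_measureI) (simp add: emeasure_restrict_space space_restrict_space emeasure_lborel_Icc_eq)

lemma perron_kernel_measurable:
  assumes "c > 0"
  shows "perron_kernel c T \<in> borel_measurable borel"
proof (cases "T > 0")
  case True
  have "isCont (perron_kernel c T) u" for u
    using perron_kernel_has_derivative[OF assms True, of u]
    by (rule has_vector_derivative_continuous)
  thus ?thesis
    by (intro borel_measurable_continuous_onI continuous_at_imp_continuous_on) auto
next
  \<comment> \<open>Dominated convergence along \<open>at_top\<close> asks for measurability at
    every \<open>T\<close>; here the interval is empty or a point.\<close>
  case False
  hence "perron_kernel c T = (\<lambda>_. 0)"
    by (cases "T = 0") (auto simp: perron_kernel_def fun_eq_iff)
  thus ?thesis by simp
qed

lemma sgn_exp_diff: "sgn (exp a - exp b) = sgn (a - b :: real)"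
  by (auto simp: sgn_if)

lemma Complex_measurable [measurable (raw)]:
  "f \<in> borel_measurable M \<Longrightarrow> g \<in> borel_measurable M \<Longrightarrow> (\<lambda>x. Complex (f x) (g x)) \<in> borel_measurable M"
  unfolding Complex_eq
  by (intro borel_measurable_add borel_measurable_times borel_measurable_const
      borel_measurable_of_real[THEN measurable_compose[rotated]])

text \<open>In the application \<open>y\<close> is the value of the characteristic polynomial at 1
  and \<open>V\<close> the squared Vandermonde. The case \<open>y x = 0\<close> is split off because
  there \<open>y\<close> to the power \<open>r\<close> is 0, whereas \<open>ln 0 = 0\<close> in HOL
  would give a nonzero exponential.\<close>

lemma (in finite_measure) has_vertical_integral_perron:
  fixes y V :: "'a \<Rightarrow> real"
  assumes [measurable]: "y \<in> borel_measurable M" "V \<in> borel_measurable M"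
    and y: "\<And>x. 0 \<le> y x" "\<And>x. y x \<le> Y" and V: "\<And>x. \<bar>V x\<bar> \<le> K" and c: "c > 0"
  shows "has_vertical_integral
           (\<lambda>r. \<integral>x. V x * (if y x = 0 then 0 else exp (r * of_real (ln (y x) - X)) / r) \<partial>M) c
           (2 * of_real pi * \<i> * of_real (\<integral>x. V x * ((1 + sgn (y x - exp X)) / 2) \<partial>M))"
proof -
  define E where "E = exp (c * (ln Y - X))"
  \<comment> \<open>Monotonicity of \<open>ln\<close> needs \<open>y x > 0\<close>; at
    \<open>y x = 0\<close> the HOL value of the left side may exceed \<open>E\<close>.\<close>
  have E: "exp (c * (ln (y x) - X)) \<le> E" if "y x \<noteq> 0" for x
    using y[of x] that c by (auto simp: E_def)
  have K: "K \<ge> 0" using order_trans[OF abs_ge_zero V] .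
  define k where "k = (\<lambda>x s. of_real (V x) *
      (if y x = 0 then 0 else exp (Complex c s * of_real (ln (y x) - X)) / Complex c s))"
  define J where "J = (\<lambda>T. \<integral>x. of_real (V x) *
      (if y x = 0 then 0 else perron_kernel c T (ln (y x) - X)) \<partial>M)"
  \<comment> \<open>Fubini at fixed height: both measures are finite, and \<open>k\<close> is
    bounded since the modulus of \<open>Complex c s\<close> is at least \<open>c\<close>.\<close>
  have 1: "((\<lambda>s. \<integral>x. k x s \<partial>M) has_integral J T) {-T..T}" if T: "T > 0" for T
  proof -
    define L where "L = restrict_space lborel {-T..T}"
    interpret L: finite_measure L unfolding L_def by (rule finite_measure_lborel_Icc)
    interpret P: pair_sigma_finite M L ..
    interpret PF: finite_measure "M \<Otimes>\<^sub>M L"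
      by (rule finite_measure_pair_measure) unfold_locales
    have [measurable]: "(\<lambda>s. s) \<in> borel_measurable L"
      unfolding L_def by (rule measurable_restrict_space1) simp
    have int: "integrable (M \<Otimes>\<^sub>M L) (case_prod k)"
    proof (rule PF.integrable_const_bound)
      have "norm (k x s) \<le> K * (E / c)" for x s
      proof -
        have "c \<le> norm (Complex c s)" using abs_Re_le_cmod[of "Complex c s"] c by simp
        hence "norm (if y x = 0 then 0 else exp (Complex c s * of_real (ln (y x) - X)) / Complex c s) \<le> E / c"
          using c E[of x] by (auto simp: norm_divide norm_exp_eq_Re E_def intro!: frac_le)
        thus ?thesis unfolding k_def norm_mult norm_of_real using V K by (intro mult_mono) auto
      qed
      thus "AE z in M \<Otimes>\<^sub>M L. norm (case_prod k z) \<le> K * (E / c)"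
        by (intro AE_I2) auto
    qed (unfold k_def, measurable)
    have "(\<integral>s. \<integral>x. k x s \<partial>M \<partial>L) = (\<integral>x. \<integral>s. k x s \<partial>L \<partial>M)"
      by (rule P.Fubini_integral[OF int])
    also have "\<dots> = J T"
      unfolding J_def
    proof (rule Bochner_Integration.integral_cong)
      fix x
      have "(\<integral>s. exp (Complex c s * of_real (ln (y x) - X)) / Complex c s \<partial>L)
          = perron_kernel c T (ln (y x) - X)"
        unfolding L_def perron_kernel_def using c
        by (intro integral_restrict_lborel_continuous continuous_intros) (auto simp: complex_eq_iff)
      thus "(\<integral>s. k x s \<partial>L) = of_real (V x) * (if y x = 0 then 0 else perron_kernel c T (ln (y x) - X))"
        by (simp add: k_def)
    qed simp
    finally have "J T = (\<integral>s. \<integral>x. k x s \<partial>M \<partial>L)" ..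
    thus ?thesis
      using has_integral_restrict_lborel[OF _ P.integrable_snd[OF int, unfolded L_def]]
      by (simp add: L_def)
  qed
  obtain B where B: "B \<ge> 0" "\<And>T u. T > 0 \<Longrightarrow> norm (perron_kernel c T u) \<le> B * exp (c * u)"
    using perron_kernel_uniform_bound[OF c] by blast
  \<comment> \<open>The bound on the kernel uniform in \<open>T\<close> supplies a constant
    dominating function. Where \<open>y x = 0\<close> both sides vanish, as
    \<open>sgn (0 - exp X) = -1\<close>.\<close>
  have "(J \<longlongrightarrow> (\<integral>x. of_real (V x * (pi * (1 + sgn (y x - exp X)))) \<partial>M)) at_top"
    unfolding J_def
  proof (rule integral_dominated_convergence_at_top)
    show "integrable M (\<lambda>_. K * (B * E))" by simp
    show "(\<lambda>x. of_real (V x) * (if y x = 0 then 0 else perron_kernel c T (ln (y x) - X)))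
        \<in> borel_measurable M" for T
      using perron_kernel_measurable[OF c, of T] by measurable
    show "(\<lambda>x. complex_of_real (V x * (pi * (1 + sgn (y x - exp X))))) \<in> borel_measurable M"
      unfolding sgn_if by measurable
    have "((\<lambda>T. of_real (V x) * (if y x = 0 then 0 else perron_kernel c T (ln (y x) - X))) \<longlongrightarrow>
        complex_of_real (V x * (pi * (1 + sgn (y x - exp X))))) at_top" for x
    proof (cases "y x = 0")
      case False
      hence "y x > 0" using y(1)[of x] by simp
      hence "sgn (y x - exp X) = sgn (ln (y x) - X)"
        using sgn_exp_diff[of "ln (y x)" X] by simp
      thus ?thesis using False perron_kernel_tendsto[OF c, of "ln (y x) - X"]
        by (auto intro!: tendsto_mult)
    qed auto
    thus "AE x in M. ((\<lambda>T. of_real (V x) * (if y x = 0 then 0 else perron_kernel c T (ln (y x) - X))) \<longlongrightarrow>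
        complex_of_real (V x * (pi * (1 + sgn (y x - exp X))))) at_top" by simp
    show "\<forall>\<^sub>F T in at_top. AE x in M. norm (of_real (V x) *
        (if y x = 0 then 0 else perron_kernel c T (ln (y x) - X))) \<le> K * (B * E)"
      using eventually_gt_at_top[of 0]
    proof eventually_elim
      case (elim T)
      have "norm (if y x = 0 then 0 else perron_kernel c T (ln (y x) - X)) \<le> B * E" for x
        using order_trans[OF B(2)[OF elim] mult_left_mono[OF E B(1)]] B(1) by (auto simp: E_def)
      thus ?case unfolding norm_mult norm_of_real using V K by (intro AE_I2 mult_mono) auto
    qed
  qed
  with 1 have "has_vertical_integral
      (\<lambda>r. \<integral>x. V x * (if y x = 0 then 0 else exp (r * of_real (ln (y x) - X)) / r) \<partial>M) c
      (\<i> * (\<integral>x. of_real (V x * (pi * (1 + sgn (y x - exp X)))) \<partial>M))"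
    unfolding k_def by (rule has_vertical_integralI)
  moreover have "\<i> * (\<integral>x. complex_of_real (V x * (pi * (1 + sgn (y x - exp X)))) \<partial>M) =
      2 * of_real pi * \<i> * of_real (\<integral>x. V x * ((1 + sgn (y x - exp X)) / 2) \<partial>M)"
  proof -
    have "(\<integral>x. V x * (pi * (1 + sgn (y x - exp X))) \<partial>M) =
        (\<integral>x. 2 * pi * (V x * ((1 + sgn (y x - exp X)) / 2)) \<partial>M)"
      by (intro Bochner_Integration.integral_cong) auto
    thus ?thesis unfolding integral_complex_of_real by simp
  qed
  ultimately show ?thesis by (simp only:)
qed

section \<open>The phase measure and the Jacobi weight\<close>

text \<open>Fubini for null sets: the measure of the exceptional set is the integral of the measures
  of its fibres in direction \<open>i\<close>, all of which are null.\<close>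

lemma (in product_sigma_finite) AE_PiM_insert:
  assumes I: "finite I" "i \<notin> I"
    and P: "{x \<in> space (Pi\<^sub>M (insert i I) M). P x} \<in> sets (Pi\<^sub>M (insert i I) M)"
    and AE: "\<And>x. x \<in> space (Pi\<^sub>M I M) \<Longrightarrow> AE s in M i. P (x(i := s))"
  shows "AE x in Pi\<^sub>M (insert i I) M. P x"
proof -
  define S where "S = {x \<in> space (Pi\<^sub>M (insert i I) M). \<not> P x}"
  have S: "S \<in> sets (Pi\<^sub>M (insert i I) M)"
    unfolding S_def by (intro sets.sets_Collect_neg P)
  have "emeasure (Pi\<^sub>M (insert i I) M) S = (\<integral>\<^sup>+ x. indicator S x \<partial>Pi\<^sub>M (insert i I) M)"
    using S by simp
  also have "\<dots> = (\<integral>\<^sup>+ x. \<integral>\<^sup>+ s. indicator S (x(i := s)) \<partial>M i \<partial>Pi\<^sub>M I M)"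
    by (rule product_nn_integral_insert[OF I]) (use S in simp)
  also have "\<dots> = (\<integral>\<^sup>+ x. \<integral>\<^sup>+ s. 0 \<partial>M i \<partial>Pi\<^sub>M I M)"
  proof (rule nn_integral_cong, rule nn_integral_cong_AE)
    fix x assume "x \<in> space (Pi\<^sub>M I M)"
    from AE[OF this] show "AE s in M i. indicator S (x(i := s)) = (0 :: ennreal)"
      by eventually_elim (simp add: S_def)
  qed
  finally show ?thesis using S by (intro AE_I[of _ _ S]) (auto simp: S_def)
qed

lemma product_sigma_finite_phase:
  "product_sigma_finite (\<lambda>_::nat. restrict_space lborel {0..pi})"
  unfolding product_sigma_finite_def
  using finite_measure_lborel_Icc[of 0 pi] by (simp add: finite_measure_def)

lemma finite_measure_phase_measure: "finite I \<Longrightarrow> finite_measure (phase_measure I)"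
proof (rule finite_measureI)
  interpret product_sigma_finite "\<lambda>_::nat. restrict_space lborel {0..pi}"
    by (rule product_sigma_finite_phase)
  assume "finite I"
  thus "emeasure (phase_measure I) (space (phase_measure I)) \<noteq> \<infinity>"
    unfolding phase_measure_def space_PiM
    by (subst emeasure_PiM)
       (auto simp: emeasure_restrict_space space_restrict_space sets_restrict_space_iff ennreal_power)
qed

lemma phase_component_measurable:
  "(\<lambda>\<theta>. (\<theta>(1 := t)) j) \<in> borel_measurable (phase_measure {2..N})" if "j \<in> {1..N}"
proof (cases "j = 1")
  case False
  have "(\<lambda>\<theta>. \<theta> j) \<in> measurable (phase_measure {2..N}) (restrict_space lborel {0..pi})"
    unfolding phase_measure_def using that False by (intro measurable_component_singleton) auto
  moreover have "(\<lambda>x. x) \<in> borel_measurable (restrict_space lborel {0..pi})"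
    by (rule measurable_restrict_space1) simp
  ultimately show ?thesis using False by (auto dest: measurable_compose)
qed simp

lemma borel_measurable_cos_phase:
  assumes "j \<in> {1..N}"
  shows "(\<lambda>\<theta>. cos ((\<theta>(1 := t)) j)) \<in> borel_measurable (phase_measure {2..N})"
  using phase_component_measurable[OF assms] by (rule measurable_compose) simp

lemma borel_measurable_vandermonde_sq:
  "(\<lambda>\<theta>. vandermonde_sq N (\<theta>(1 := t))) \<in> borel_measurable (phase_measure {2..N})"
  unfolding vandermonde_sq_def
  by (intro borel_measurable_prod borel_measurable_power borel_measurable_diff borel_measurable_cos_phase)
     auto

lemma vandermonde_sq_bound: "\<bar>vandermonde_sq N \<theta>\<bar> \<le> (\<Prod>j\<in>{1..N}. \<Prod>k\<in>{j<..N}. 2\<^sup>2)"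
proof -
  have "\<bar>cos a - cos b\<bar> \<le> 2" for a b :: real
    using cos_le_one[of a] cos_le_one[of b] cos_ge_minus_one[of a] cos_ge_minus_one[of b] by linarith
  thus ?thesis
    unfolding vandermonde_sq_def abs_prod power_abs by (intro prod_mono power_mono conjI prod_nonneg) auto
qed

section \<open>Complex powers and the Jacobi weight\<close>

lemma prod_of_real_powr:
  assumes "finite A" "\<And>j. j \<in> A \<Longrightarrow> 0 \<le> a j"
  shows "(\<Prod>j\<in>A. complex_of_real (a j) powr r) = of_real (\<Prod>j\<in>A. a j) powr r"
  using assms
  by (induction A rule: finite_induct) (auto simp: powr_times_real prod_nonneg simp del: of_real_prod)

lemma complex_two_powr_mult: "(2::complex) powr (of_nat n * r) = (2 powr r) ^ n"
  by (simp add: powr_def exp_of_nat_mult mult.assoc)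

text \<open>The exponents become \<open>r\<close> and 0. The second factor is then 1, also at
  \<open>x = -1\<close>, and for nonzero \<open>r\<close> the first is an ordinary power, equal to 0
  at \<open>x = 1\<close>.\<close>

lemma jacobi_weight_half:
  assumes "r \<noteq> 0"
  shows "jacobi_weight (r - 1/2) (-1/2) x = of_real (1 - x) powr r"
  using assms by (simp add: jacobi_weight_def cpow_def)

text \<open>The \<open>N\<close> copies of \<open>2 powr r\<close> join the factors
  \<open>1 - cos (\<theta> j)\<close>. Merging complex powers is legitimate because all bases are
  nonnegative reals.\<close>

lemma prod_jacobi_weight:
  assumes "r \<noteq> 0"
  shows "2 powr (of_nat N * r) * (\<Prod>j\<in>{1..N}. jacobi_weight (r - 1/2) (-1/2) (cos (\<theta> j))) =
         of_real (\<Prod>j\<in>{1..N}. 2 * (1 - cos (\<theta> j))) powr r"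
proof -
  have "2 powr (of_nat N * r) * (\<Prod>j\<in>{1..N}. jacobi_weight (r - 1/2) (-1/2) (cos (\<theta> j))) =
      (\<Prod>j\<in>{1..N}. of_real 2 powr r * of_real (1 - cos (\<theta> j)) powr r)"
    by (simp only: jacobi_weight_half[OF assms] complex_two_powr_mult prod.distrib) simp
  also have "\<dots> = (\<Prod>j\<in>{1..N}. of_real (2 * (1 - cos (\<theta> j))) powr r)"
    unfolding of_real_mult by (intro prod.cong refl powr_times_real[symmetric]) auto
  also have "\<dots> = of_real (\<Prod>j\<in>{1..N}. 2 * (1 - cos (\<theta> j))) powr r"
    by (rule prod_of_real_powr) auto
  finally show ?thesis .
qed

text \<open>Brings the integrand of the theorem, for fixed phases, into the shape that
  \<open>has_vertical_integral_perron\<close> handles.\<close>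

lemma jacobi_integrand:
  assumes "r \<noteq> 0" and y: "y = (\<Prod>j\<in>{1..N}. 2 * (1 - cos (\<theta> j)))"
  shows "2 powr (of_nat N * r) * (exp (- r * of_real X) / r) *
           ((\<Prod>j\<in>{1..N}. jacobi_weight (r - 1/2) (-1/2) (cos (\<theta> j))) * of_real v) =
         of_real v * (if y = 0 then 0 else exp (r * of_real (ln y - X)) / r)"
proof -
  have "y \<ge> 0" unfolding y by (intro prod_nonneg) auto
  hence "of_real y powr r = (if y = 0 then 0 else exp (r * of_real (ln y)))"
    by (auto simp: powr_def Ln_of_real)
  moreover have "2 powr (of_nat N * r) * (exp (- r * of_real X) / r) *
           ((\<Prod>j\<in>{1..N}. jacobi_weight (r - 1/2) (-1/2) (cos (\<theta> j))) * of_real v) =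
         of_real v * (of_real y powr r * (exp (- r * of_real X) / r))"
    unfolding prod_jacobi_weight[OF assms(1), of N \<theta>, folded y, symmetric] by (simp add: mult_ac)
  ultimately show ?thesis
    by (auto simp: algebra_simps exp_diff exp_minus divide_simps)
qed

text \<open>Off the jump, \<open>H\<close> is fully determined and equals the mean value that
  Perron's formula produces; the free value \<open>H 0\<close> matters only on the level set
  \<open>y = exp X\<close>.\<close>

lemma excised_weight_eq:
  assumes H: "is_heaviside H"
    and y: "y = (\<Prod>j\<in>{1..N}. 2 * (1 - cos (\<theta> j)))"
  shows "excised_weight H N X \<theta> = vandermonde_sq N \<theta> *
           (if y = exp X then H 0 else (1 + sgn (y - exp X)) / 2)"
proof -
  have y0: "y \<ge> 0" unfolding y by (intro prod_nonneg) auto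
  have L: "cmod (Lambda_phase N \<theta> 0) = y"
    unfolding Lambda_phase_0 y[symmetric] using y0 by simp
  have "H (log_ext y - ereal X) = (if y = exp X then H 0 else (1 + sgn (y - exp X)) / 2)"
  proof (cases "y = 0")
    \<comment> \<open>Here \<open>log_ext\<close> gives minus infinity, so \<open>H\<close> is
      evaluated at a negative argument, in accordance with
      \<open>sgn (- exp X) = -1\<close>.\<close>
    case True
    thus ?thesis using H by (simp add: log_ext_def is_heaviside_def)
  next
    case False
    hence *: "y = exp (ln y)" using y0 by simp
    have "sgn (y - exp X) = sgn (ln y - X)" by (subst *) (rule sgn_exp_diff)
    moreover have "y = exp X \<longleftrightarrow> ln y = X" by (metis * ln_exp)
    moreover have "H (ereal (ln y - X)) = (if ln y = X then H 0 else (1 + sgn (ln y - X)) / 2)"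
      using H by (cases "ln y" X rule: linorder_cases) (auto simp: is_heaviside_def zero_ereal_def)
    ultimately show ?thesis using False by (simp add: log_ext_def)
  qed
  thus ?thesis by (simp add: excised_weight_def L)
qed

text \<open>For \<open>N\<close> at least 2 the phase with index 2 is free. With all other phases
  fixed, the product is a constant times \<open>1 - cos s\<close>, which takes the value
  \<open>exp X\<close> at most once on \<open>{0..pi}\<close> because \<open>cos\<close> is
  injective there.\<close>

lemma AE_phase_prod_neq:
  assumes "N \<ge> 2"
  shows "AE \<theta> in phase_measure {2..N}. (\<Prod>j\<in>{1..N}. 2 * (1 - cos ((\<theta>(1 := t)) j))) \<noteq> exp X"
proof -
  define L where "L = restrict_space lborel {0..pi}"
  interpret product_sigma_finite "\<lambda>_::nat. L"
    unfolding L_def by (rule product_sigma_finite_phase)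
  define f where "f \<theta> = (\<Prod>j\<in>{1..N}. 2 * (1 - cos ((\<theta>(1 := t)) j)))" for \<theta>
  have f [measurable]: "f \<in> borel_measurable (phase_measure {2..N})"
    unfolding f_def
    by (intro borel_measurable_prod borel_measurable_times borel_measurable_diff borel_measurable_cos_phase
        borel_measurable_const)
  have N: "{2..N} = insert 2 {3..N}" using assms by auto
  have meas: "{\<theta> \<in> space (phase_measure {2..N}). f \<theta> \<noteq> exp X} \<in> sets (phase_measure {2..N})"
    by measurable
  have "AE \<theta> in Pi\<^sub>M (insert 2 {3..N}) (\<lambda>_. L). f \<theta> \<noteq> exp X"
  proof (rule AE_PiM_insert)
    show "{x \<in> space (Pi\<^sub>M (insert 2 {3..N}) (\<lambda>_. L)). f x \<noteq> exp X} \<in> sets (Pi\<^sub>M (insert 2 {3..N}) (\<lambda>_. L))"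
      using meas by (simp add: phase_measure_def N L_def)
    fix \<theta> :: "nat \<Rightarrow> real"
    define a where "a = 2 * (\<Prod>j\<in>{1..N}-{2}. 2 * (1 - cos ((\<theta>(1 := t)) j)))"
    have fa: "f (\<theta>(2 := s)) = a * (1 - cos s)" for s
    proof -
      have "f (\<theta>(2 := s)) = (2 * (1 - cos s)) * (\<Prod>j\<in>{1..N}-{2}. 2 * (1 - cos ((\<theta>(2 := s, 1 := t)) j)))"
        unfolding f_def using assms by (subst prod.remove[of _ 2]) auto
      also have "(\<Prod>j\<in>{1..N}-{2}. 2 * (1 - cos ((\<theta>(2 := s, 1 := t)) j))) =
          (\<Prod>j\<in>{1..N}-{2}. 2 * (1 - cos ((\<theta>(1 := t)) j)))"
        by (intro prod.cong) auto
      finally show ?thesis by (simp only: a_def mult_ac)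
    qed
    \<comment> \<open>A solution forces \<open>a\<close> to be nonzero, since \<open>exp X\<close>
      is; if there is none, any \<open>s\<^sub>0\<close> will do.\<close>
    obtain s\<^sub>0 where s\<^sub>0: "\<And>s. s \<in> {0..pi} \<Longrightarrow> a * (1 - cos s) = exp X \<Longrightarrow> s = s\<^sub>0"
    proof (cases "\<exists>s\<in>{0..pi}. a * (1 - cos s) = exp X")
      case True
      then obtain s\<^sub>1 where s\<^sub>1: "s\<^sub>1 \<in> {0..pi}" "a * (1 - cos s\<^sub>1) = exp X" by blast
      hence "a \<noteq> 0" by auto
      show ?thesis
      proof (rule that)
        fix s assume s: "s \<in> {0..pi}" "a * (1 - cos s) = exp X"
        with s\<^sub>1 \<open>a \<noteq> 0\<close> have "cos s = cos s\<^sub>1"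
          by (metis diff_diff_eq2 add_diff_cancel_left' mult_left_cancel diff_left_imp_eq)
        thus "s = s\<^sub>1" using s s\<^sub>1 cos_inj_pi by auto
      qed
    qed blast
    have "AE s in lborel. s \<noteq> s\<^sub>0" by (rule AE_lborel_singleton)
    hence "AE s in lborel. s \<in> {0..pi} \<longrightarrow> a * (1 - cos s) \<noteq> exp X"
      by eventually_elim (use s\<^sub>0 in blast)
    thus "AE s in L. f (\<theta>(2 := s)) \<noteq> exp X"
      unfolding L_def fa by (subst AE_restrict_space_iff) auto
  qed auto
  thus ?thesis by (simp only: phase_measure_def N L_def f_def)
qed

text \<open>The proviso on \<open>H 0\<close> concerns the one case where the jump is not
  negligible: for \<open>N = 1\<close> the remaining integral is over a one-point space of mass 1,
  so the truncated integrals tend to the mean value 1/2 at the jump, and the density has to agree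
  with that.\<close>

theorem theorem1:
  fixes N :: nat and X C c :: real and H :: "ereal \<Rightarrow> real"
  assumes "N \<ge> 1"
    and "is_heaviside H"
    and "1 = C * excised_mass H N X"
    and "c > 0"
  shows "(\<forall>A\<in>special_orthogonal (2 * N). \<forall>\<theta>. eigenphases N A \<theta> \<longrightarrow>
           (\<forall>\<phi>. Lambda_mat A (cis \<phi>) = Lambda_phase N \<theta> \<phi>) \<and>
           Lambda_mat A 1 = of_real (2 ^ N * (\<Prod>j\<in>{1..N}. 1 - cos (\<theta> j))) \<and>
           (A \<in> excised_set N X \<longleftrightarrow> log_ext (cmod (Lambda_phase N \<theta> 0)) \<ge> ereal X)) \<and>
         (\<forall>\<theta>\<^sub>1\<in>{0..pi}. (N = 1 \<and> 2 * (1 - cos \<theta>\<^sub>1) = exp X \<longrightarrow> H 0 = 1/2) \<longrightarrow>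
           (\<exists>I. has_vertical_integral
                  (\<lambda>r. 2 powr (of_nat N * r) * (exp (- r * of_real X) / r) *
                       jacobi_density N (r - 1/2) (- 1/2) \<theta>\<^sub>1) c I \<and>
                of_real (excised_density H N X C \<theta>\<^sub>1) = of_real C / (2 * of_real pi * \<i>) * I))"
proof (intro conjI ballI allI impI)
  fix A \<theta> \<phi> assume A: "A \<in> special_orthogonal (2 * N)" "eigenphases N A \<theta>"
  show "Lambda_mat A (cis \<phi>) = Lambda_phase N \<theta> \<phi>"
    by (rule Lambda_mat_cis[OF A])
  have 1: "Lambda_mat A 1 = Lambda_phase N \<theta> 0"
    using Lambda_mat_cis[OF A, of 0] by simp
  show "Lambda_mat A 1 = of_real (2 ^ N * (\<Prod>j\<in>{1..N}. 1 - cos (\<theta> j)))"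
    by (simp only: 1 Lambda_phase_0 prod.distrib) simp
  show "A \<in> excised_set N X \<longleftrightarrow> log_ext (cmod (Lambda_phase N \<theta> 0)) \<ge> ereal X"
    using A by (simp add: excised_set_def 1)
next
  fix t assume t: "N = 1 \<and> 2 * (1 - cos t) = exp X \<longrightarrow> H 0 = 1/2"
  define M where "M = phase_measure {2..N}"
  interpret finite_measure M unfolding M_def by (rule finite_measure_phase_measure) simp
  define y where "y \<theta> = (\<Prod>j\<in>{1..N}. 2 * (1 - cos ((\<theta>(1 := t)) j)))" for \<theta>
  define V where "V \<theta> = vandermonde_sq N (\<theta>(1 := t))" for \<theta>
  have [measurable]: "y \<in> borel_measurable M" "V \<in> borel_measurable M"
    unfolding y_def V_def M_def
    by (intro borel_measurable_prod borel_measurable_times borel_measurable_diff borel_measurable_cos_phase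
        borel_measurable_const borel_measurable_vandermonde_sq; assumption)+
  have cos_bounds: "0 \<le> 2 * (1 - cos a) \<and> 2 * (1 - cos a) \<le> 4" for a :: real
    by (smt (verit) cos_ge_minus_one cos_le_one)
  have y: "0 \<le> y \<theta>" "y \<theta> \<le> (\<Prod>j\<in>{1..N}. 4)" for \<theta>
    unfolding y_def using cos_bounds by (auto intro!: prod_nonneg prod_mono simp del: prod_constant)
  have V: "\<bar>V \<theta>\<bar> \<le> (\<Prod>j\<in>{1..N}. \<Prod>k\<in>{j<..N}. 2\<^sup>2)" for \<theta>
    unfolding V_def by (rule vandermonde_sq_bound)
  define W where "W = (\<integral>\<theta>. V \<theta> * ((1 + sgn (y \<theta> - exp X)) / 2) \<partial>M)"
  define g where "g = (\<lambda>r :: complex. \<integral>\<theta>. V \<theta> * (if y \<theta> = 0 then 0 else exp (r * of_real (ln (y \<theta>) - X)) / r) \<partial>M)"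
  have g: "has_vertical_integral g c (2 * of_real pi * \<i> * of_real W)"
    unfolding g_def W_def
    by (rule has_vertical_integral_perron[OF _ _ y V \<open>c > 0\<close>]) measurable
  \<comment> \<open>The prefactors depend on \<open>r\<close> only, so they move under the integral
    over the phases.\<close>
  have eq: "2 powr (of_nat N * r) * (exp (- r * of_real X) / r) * jacobi_density N (r - 1/2) (- 1/2) t =
      of_nat N * g r" if "r \<noteq> 0" for r
  proof -
    have "2 powr (of_nat N * r) * (exp (- r * of_real X) / r) * jacobi_density N (r - 1/2) (- 1/2) t =
        of_nat N * (\<integral>\<theta>. 2 powr (of_nat N * r) * (exp (- r * of_real X) / r) *
           ((\<Prod>j\<in>{1..N}. jacobi_weight (r - 1/2) (-1/2) (cos ((\<theta>(1 := t)) j))) * of_real (V \<theta>)) \<partial>M)"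
      unfolding jacobi_density_def Let_def M_def V_def integral_mult_right_zero by (simp only: mult_ac)
    also have "\<dots> = of_nat N * g r"
      unfolding jacobi_integrand[OF that y_def] g_def ..
    finally show ?thesis .
  qed
  \<comment> \<open>For \<open>N = 1\<close> the integrands agree pointwise, \<open>y\<close> being
    the constant \<open>2 * (1 - cos t)\<close>; otherwise they agree off the null set where
    \<open>y\<close> equals \<open>exp X\<close>.\<close>
  have W: "(\<integral>\<theta>. excised_weight H N X (\<theta>(1 := t)) \<partial>M) = W"
  proof (cases "N = 1")
    case True
    hence "y \<theta> = exp X \<longrightarrow> H 0 = 1/2" for \<theta>
      using t by (simp add: y_def)
    thus ?thesis unfolding W_def V_def
      by (intro Bochner_Integration.integral_cong refl, subst excised_weight_eq[OF assms(2) y_def]) auto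
  next
    case False
    hence "N \<ge> 2" using assms(1) by simp
    have "AE \<theta> in M. y \<theta> \<noteq> exp X"
      unfolding M_def y_def by (rule AE_phase_prod_neq) fact
    thus ?thesis
      unfolding W_def excised_weight_eq[OF assms(2) y_def] V_def[symmetric] sgn_if
      by (intro integral_cong_AE) (measurable, auto elim: eventually_mono)
  qed
  have "has_vertical_integral
        (\<lambda>r. 2 powr (of_nat N * r) * (exp (- r * of_real X) / r) * jacobi_density N (r - 1/2) (- 1/2) t) c
        (of_nat N * (2 * of_real pi * \<i> * of_real W))"
    by (rule has_vertical_integral_mult_cong[OF g], rule eq) (use \<open>c > 0\<close> in auto)
  moreover have "of_real (excised_density H N X C t) =
      of_real C / (2 * of_real pi * \<i>) * (of_nat N * (2 * of_real pi * \<i> * of_real W))"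
  proof -
    have cancel: "a / p * (n * (p * w)) = a * n * w" if "p \<noteq> 0" for a p n w :: complex
      using that by simp
    show ?thesis
      unfolding excised_density_def W[unfolded M_def] by (subst cancel) simp_all
  qed
  ultimately show "\<exists>I. has_vertical_integral
                  (\<lambda>r. 2 powr (of_nat N * r) * (exp (- r * of_real X) / r) *
                       jacobi_density N (r - 1/2) (- 1/2) t) c I \<and>
                of_real (excised_density H N X C t) = of_real C / (2 * of_real pi * \<i>) * I"
    by blast
qed

end
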